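(* For every $n$ (and every $m\ge1$), an optimal schedule for SMC-UNIT$(K_m,n)$, where $K_m$ is the complete graph on $m$ vertices, can be computed in time linear in $\log n$. In particular, for $m\ge 2$, it coincides with an optimal schedule for $K_2$, of makespan $4\lfloor n/2\rfloor+3\,(n \bmod 2)$.
   Context: SMC-UNIT$(G,n)$ is the following problem. Given a finite simple conflict graph $G=(V,E)$ whose vertices are machines, and $n$ identical unit jobs, each consisting of a first blocking time of length $1$, followed by a processing time of length $1$, followed by a second blocking time of length $1$ (total system time $3$). A (conflict-free) schedule $\Pi$ assigns to each job $j$ a machine and a starting time $S_j\ge 0$; $j$ occupies its machine, without preemption, during $(S_j,S_j+3)$, and its blocking intervals are $[S_j,S_j+1]$ and $[S_j+2,S_j+3]$. Requirements: each machine executes at most one job at any time, and for any two jobs on machines $i,i'$ with $\{i,i'\}\in E$, no blocking interval of one overlaps interiorly with a blocking interval of the other. The makespan is $\|\Pi\|=\max_j (S_j+3)$; an optimal schedule is one of minimum makespan. "Coincides with an optimal schedule for $K_2$" means that an optimal schedule of $n$ jobs on $K_2$, placed on two of the $m$ machines with all other machines idle, is optimal for $K_m$. Schedules are output in a compact description. *)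

theory Defs
  imports "HOL-Analysis.Analysis" "HOL-Library.Landau_Symbols"
begin

section \<open>Scheduling unit jobs with machine conflicts\<close>

text \<open>A conflict graph is a pair of a vertex set (the machines) and a set of edges, each edge being
  a two-element set of vertices.\<close>

type_synonym 'v graph = "'v set \<times> 'v set set"

definition simple_graph :: "'v graph \<Rightarrow> bool" where
  "simple_graph G \<longleftrightarrow> finite (fst G) \<and> (\<forall>e\<in>snd G. e \<subseteq> fst G \<and> card e = 2)"

definition complete_graph :: "nat \<Rightarrow> nat graph" where
  "complete_graph m = ({..<m}, {{i, j} |i j. i < m \<and> j < m \<and> i \<noteq> j})"

lemma simple_graph_complete_graph: "simple_graph (complete_graph m)"
  by (auto simp: simple_graph_def complete_graph_def)

text \<open>A schedule of \<open>n\<close> jobs is a list of length \<open>n\<close>; its \<open>j\<close>-th entry is the machine and the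
  starting time of job \<open>j\<close>.\<close>

type_synonym 'v schedule = "('v \<times> real) list"

definition blocking_intervals :: "real \<Rightarrow> real set set" where
  "blocking_intervals s = {{s..s + 1}, {s + 2..s + 3}}"

definition conflict_free_schedule :: "'v graph \<Rightarrow> nat \<Rightarrow> 'v schedule \<Rightarrow> bool" where
  "conflict_free_schedule G n P \<longleftrightarrow>
     length P = n \<and>
     (\<forall>(i, s)\<in>set P. i \<in> fst G \<and> 0 \<le> s) \<and>
     (\<forall>j<n. \<forall>k<n. j \<noteq> k \<longrightarrow> fst (P ! j) = fst (P ! k) \<longrightarrow>
        {snd (P ! j)<..<snd (P ! j) + 3} \<inter> {snd (P ! k)<..<snd (P ! k) + 3} = {}) \<and>
     (\<forall>j<n. \<forall>k<n. {fst (P ! j), fst (P ! k)} \<in> snd G \<longrightarrow>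
        (\<forall>I\<in>blocking_intervals (snd (P ! j)). \<forall>J\<in>blocking_intervals (snd (P ! k)).
           interior I \<inter> interior J = {}))"

text \<open>As starting times are nonnegative, inserting \<open>0\<close> only matters for the empty schedule.\<close>

definition makespan :: "'v schedule \<Rightarrow> real" where
  "makespan P = Max (insert 0 ((\<lambda>(i, s). s + 3) ` set P))"

definition optimal_schedule :: "'v graph \<Rightarrow> nat \<Rightarrow> 'v schedule \<Rightarrow> bool" where
  "optimal_schedule G n P \<longleftrightarrow>
     conflict_free_schedule G n P \<and>
     (\<forall>Q. conflict_free_schedule G n Q \<longrightarrow> makespan P \<le> makespan Q)"

definition place_on :: "('v \<Rightarrow> 'w) \<Rightarrow> 'v schedule \<Rightarrow> 'w schedule" where
  "place_on f P = map (\<lambda>(i, s). (f i, s)) P"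


section \<open>Compact descriptions of schedules\<close>

text \<open>A description is a list of blocks. The block \<open>(r, p, js)\<close> stands for \<open>r\<close> consecutive copies of
  a pattern of length \<open>p\<close>, which starts a job on machine \<open>i\<close> at offset \<open>s\<close> for every \<open>(i, s)\<close> in
  \<open>js\<close>; each block starts when the preceding block ends.\<close>

type_synonym description = "(nat \<times> nat \<times> (nat \<times> nat) list) list"

fun unfold_from :: "nat \<Rightarrow> description \<Rightarrow> nat schedule" where
  "unfold_from t [] = []"
| "unfold_from t ((r, p, js) # d) =
     concat (map (\<lambda>l. map (\<lambda>(i, s). (i, real (t + l * p + s))) js) [0..<r]) @
     unfold_from (t + r * p) d"

definition described_schedule :: "description \<Rightarrow> nat schedule" where
  "described_schedule d = unfold_from 0 d"

datatype symbol = Blank | Bit bool | Sep | End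

text \<open>Binary notation, least significant bit first, without superfluous zeros.\<close>

fun binary_word :: "nat \<Rightarrow> symbol list" where
  "binary_word n = (if n = 0 then [] else Bit (odd n) # binary_word (n div 2))"

declare binary_word.simps [simp del]

definition encode_number :: "nat \<Rightarrow> symbol list" where
  "encode_number x = binary_word x @ [Sep]"

fun encode_block :: "nat \<times> nat \<times> (nat \<times> nat) list \<Rightarrow> symbol list" where
  "encode_block (r, p, js) =
     encode_number r @ encode_number p @
     concat (map (\<lambda>(i, s). encode_number i @ encode_number s) js) @ [End]"

definition encode_description :: "description \<Rightarrow> symbol list" where
  "encode_description d = concat (map encode_block d)"

lemma set_binary_word: "set (binary_word n) \<subseteq> range Bit"
proof (induction n rule: binary_word.induct)
  case (1 n)
  then show ?case by (subst binary_word.simps) auto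
qed

lemma binary_word_inject: "binary_word x = binary_word y \<longleftrightarrow> x = y"
proof
  show "binary_word x = binary_word y \<Longrightarrow> x = y"
  proof (induction x arbitrary: y rule: binary_word.induct)
    case (1 x)
    show ?case
    proof (cases "x = 0 \<or> y = 0")
      case True
      then show ?thesis using 1(2) by (subst (asm) (1 2) binary_word.simps) (auto split: if_splits)
    next
      case False
      then have "odd x = odd y" "binary_word (x div 2) = binary_word (y div 2)"
        using 1(2) by (subst (asm) (1 2) binary_word.simps; simp)+
      with 1(1) False have "x div 2 = y div 2" "odd x = odd y" by auto
      then show ?thesis by (metis even_two_times_div_two odd_two_times_div_two_succ)
    qed
  qed
qed auto

lemma encode_number_append_inject:
  "encode_number x @ u = encode_number y @ v \<longleftrightarrow> x = y \<and> u = v"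
proof
  assume *: "encode_number x @ u = encode_number y @ v"
  have tw: "takeWhile (\<lambda>c. c \<in> range Bit) (encode_number z @ w) = binary_word z" for z w
    using set_binary_word[of z] by (auto simp: encode_number_def subset_iff takeWhile_append)
  from tw[of x u] tw[of y v] * have "binary_word x = binary_word y" by simp
  then have "x = y" by (simp add: binary_word_inject)
  with * show "x = y \<and> u = v" by simp
qed auto

lemma encode_number_neq_End: "encode_number x @ u \<noteq> End # v"
  using set_binary_word[of x] by (cases "binary_word x") (auto simp: encode_number_def)

lemma encode_block_append_inject:
  "encode_block b @ u = encode_block c @ v \<longleftrightarrow> b = c \<and> u = v"
proof -
  have "js = ks \<and> u = v"
    if "concat (map (\<lambda>(i, s). encode_number i @ encode_number s) js) @ End # u =
        concat (map (\<lambda>(i, s). encode_number i @ encode_number s) ks) @ End # v" for js ks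
    using that
  proof (induction js arbitrary: ks)
    case Nil
    then show ?case
      by (cases ks) (auto simp: encode_number_neq_End[symmetric])
  next
    case (Cons a js)
    then show ?case
      by (cases ks; cases a) (auto simp: encode_number_neq_End encode_number_append_inject)
  qed
  then show ?thesis
    by (cases b; cases c) (auto simp: encode_number_append_inject)
qed

lemma encode_block_neq_Nil: "encode_block b \<noteq> []"
  by (cases b) auto

lemma inj_encode_description: "inj encode_description"
proof (rule injI)
  show "encode_description d = encode_description e \<Longrightarrow> d = e" for d e
  proof (induction d arbitrary: e)
    case Nil
    then show ?case by (cases e) (auto simp: encode_description_def encode_block_neq_Nil)
  next
    case (Cons b d)
    then show ?case
      by (cases e)
        (auto simp: encode_description_def encode_block_neq_Nil encode_block_append_inject)
  qed
qed


section \<open>Multi-tape Turing machines\<close>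

text \<open>Tapes are infinite to the right; a head on the leftmost cell ignores the move \<open>Left\<close>. The
  transition function maps a state and the list of scanned symbols to the next state and, for each
  tape, the symbol to be written and the head movement; the machine halts where it is \<open>None\<close>.\<close>

datatype move = Left | Stay | Right

type_synonym tape = "(nat \<Rightarrow> symbol) \<times> nat"
type_synonym config = "nat \<times> tape list"

record turing_machine =
  num_tapes :: nat
  num_states :: nat
  transition :: "nat \<Rightarrow> symbol list \<Rightarrow> (nat \<times> (symbol \<times> move) list) option"

text \<open>The symbols form a finite type, so only finitely many values of the transition function are
  relevant.\<close>

definition wf_turing_machine :: "turing_machine \<Rightarrow> bool" where
  "wf_turing_machine M \<longleftrightarrow>
     0 < num_tapes M \<and> 0 < num_states M \<and>
     (\<forall>q<num_states M. \<forall>xs. length xs = num_tapes M \<longrightarrow>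
        (\<forall>q' as. transition M q xs = Some (q', as) \<longrightarrow>
           q' < num_states M \<and> length as = num_tapes M))"

fun move_head :: "move \<Rightarrow> nat \<Rightarrow> nat" where
  "move_head Left h = h - 1"
| "move_head Stay h = h"
| "move_head Right h = h + 1"

fun act :: "symbol \<times> move \<Rightarrow> tape \<Rightarrow> tape" where
  "act (x, mv) (c, h) = (c(h := x), move_head mv h)"

fun next_action :: "turing_machine \<Rightarrow> config \<Rightarrow> (nat \<times> (symbol \<times> move) list) option" where
  "next_action M (q, ts) = transition M q (map (\<lambda>(c, h). c h) ts)"

definition halted :: "turing_machine \<Rightarrow> config \<Rightarrow> bool" where
  "halted M C \<longleftrightarrow> next_action M C = None"

definition step :: "turing_machine \<Rightarrow> config \<Rightarrow> config" where
  "step M C = (case next_action M C of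
     None \<Rightarrow> C
   | Some (q', as) \<Rightarrow> (q', map2 act as (snd C)))"

definition tape_content :: "symbol list \<Rightarrow> nat \<Rightarrow> symbol" where
  "tape_content w i = (if i < length w then w ! i else Blank)"

definition initial_config :: "turing_machine \<Rightarrow> symbol list list \<Rightarrow> config" where
  "initial_config M ws =
     (0, map (\<lambda>i. (tape_content (if i < length ws then ws ! i else []), 0)) [0..<num_tapes M])"

text \<open>Every input word is written on a tape of its own; the output is the final content of the last
  tape, which is blank at the start.\<close>

definition computes_within ::
    "turing_machine \<Rightarrow> nat \<Rightarrow> symbol list list \<Rightarrow> symbol list \<Rightarrow> bool" where
  "computes_within M t ws out \<longleftrightarrow>
     length ws < num_tapes M \<and>
     (let C = (step M ^^ t) (initial_config M ws)
      in halted M C \<and> fst (last (snd C)) = tape_content out)"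

end

theory Submission
  imports Defs
begin

text \<open>On a complete graph, two starting times differ by exactly \<open>1\<close> (on different machines) or by
  at least \<open>3\<close>. So among three consecutive starting times the first and the last are at least \<open>4\<close>
  apart, a bound that two machines attain by starting pairs of jobs at times \<open>4 l\<close> and \<open>4 l + 1\<close>.
  A compact description needs only the number \<open>n div 2\<close> of pairs, which a Turing machine obtains by
  dropping the lowest bit of \<open>n\<close>; of \<open>m\<close> it needs to know only whether there is a second bit.\<close>

section \<open>Schedules on complete graphs\<close>

lemma disjoint_open_intervals_iff:
  fixes s t l :: real
  assumes "0 < l"
  shows "{s<..<s + l} \<inter> {t<..<t + l} = {} \<longleftrightarrow> l \<le> \<bar>s - t\<bar>"
proof
  show "l \<le> \<bar>s - t\<bar>" if *: "{s<..<s + l} \<inter> {t<..<t + l} = {}"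
  proof (rule ccontr)
    assume "\<not> l \<le> \<bar>s - t\<bar>"
    \<comment> \<open>For overlapping intervals the intersection runs from \<open>max s t\<close> to
      \<open>min s t + l\<close>; the witness is its midpoint.\<close>
    then have "(s + t + l) / 2 \<in> {s<..<s + l} \<inter> {t<..<t + l}" by (auto simp: abs_if split: if_splits)
    with * show False by blast
  qed
qed (auto simp: abs_if split: if_splits)

text \<open>Put d = \<open>\<bar>s - t\<bar>\<close>. The left ends of the unit blocking intervals
  lie at distances d, d + 2 and \<open>\<bar>d - 2\<bar>\<close> from each other, and all of these
  must be at least 1. This excludes d < 1 and 1 < d < 3.\<close>

lemma blocking_intervals_disjoint_iff:
  "(\<forall>I\<in>blocking_intervals s. \<forall>J\<in>blocking_intervals t. interior I \<inter> interior J = {})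
    \<longleftrightarrow> \<bar>s - t\<bar> = 1 \<or> 3 \<le> \<bar>s - t\<bar>"
proof -
  have "interior {a..a'} \<inter> interior {b..b'} = {} \<longleftrightarrow> 1 \<le> \<bar>a - b\<bar>"
    if "a' = a + 1" "b' = b + 1" for a a' b b' :: real
    unfolding that interior_atLeastAtMost_real by (rule disjoint_open_intervals_iff) simp
  then show ?thesis
    unfolding blocking_intervals_def by (auto simp: abs_if split: if_splits)
qed

lemma complete_graph_edge_iff:
  "{i, j} \<in> snd (complete_graph m) \<longleftrightarrow> i < m \<and> j < m \<and> i \<noteq> j"
  by (auto simp: complete_graph_def doubleton_eq_iff)

text \<open>Two different machines are always adjacent here, so every pair of jobs falls under
  exactly one of the two disjointness conditions, and both become conditions on the distance of the
  starting times.\<close>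

lemma conflict_free_complete_graph_iff:
  "conflict_free_schedule (complete_graph m) n P \<longleftrightarrow>
     length P = n \<and> (\<forall>(i, s)\<in>set P. i < m \<and> 0 \<le> s) \<and>
     (\<forall>j<n. \<forall>k<n. j \<noteq> k \<longrightarrow>
        3 \<le> \<bar>snd (P ! j) - snd (P ! k)\<bar> \<or>
        fst (P ! j) \<noteq> fst (P ! k) \<and> \<bar>snd (P ! j) - snd (P ! k)\<bar> = 1)"
  (is "_ \<longleftrightarrow> ?len \<and> ?range \<and> ?sep")
proof (cases "?len \<and> ?range")
  case True
  define E D where "E j k \<longleftrightarrow> fst (P ! j) = fst (P ! k)" and "D j k = \<bar>snd (P ! j) - snd (P ! k)\<bar>"
    for j k
  have vertex: "fst (P ! j) < m" if "j < n" for j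
    using that True nth_mem[of j P] by (cases "P ! j") auto
  \<comment> \<open>The edge condition does not ask for \<open>j \<noteq> k\<close>; this fact makes
    it vacuous on the diagonal.\<close>
  have diag: "E j j" for j by (simp add: E_def)
  have "conflict_free_schedule (complete_graph m) n P \<longleftrightarrow>
      (\<forall>j<n. \<forall>k<n. j \<noteq> k \<longrightarrow> E j k \<longrightarrow> 3 \<le> D j k) \<and>
      (\<forall>j<n. \<forall>k<n. \<not> E j k \<longrightarrow> D j k = 1 \<or> 3 \<le> D j k)"
    using True vertex
    unfolding conflict_free_schedule_def blocking_intervals_disjoint_iff complete_graph_edge_iff
      disjoint_open_intervals_iff[OF zero_less_numeral] E_def D_def
    by (simp add: complete_graph_def)
  also have "\<dots> \<longleftrightarrow> (\<forall>j<n. \<forall>k<n. j \<noteq> k \<longrightarrow> 3 \<le> D j k \<or> \<not> E j k \<and> D j k = 1)"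
  proof -
    have "(j \<noteq> k \<longrightarrow> 3 \<le> D j k \<or> \<not> E j k \<and> D j k = 1) \<longleftrightarrow>
        (j \<noteq> k \<longrightarrow> E j k \<longrightarrow> 3 \<le> D j k) \<and> (\<not> E j k \<longrightarrow> D j k = 1 \<or> 3 \<le> D j k)" for j k
      using diag[of j] by auto
    then show ?thesis by (simp only:) blast
  qed
  finally show ?thesis using True unfolding E_def D_def by simp
next
  case False
  then show ?thesis by (auto simp: conflict_free_schedule_def complete_graph_def)
qed

section \<open>Lower bounds for the makespan\<close>

definition k2_makespan :: "nat \<Rightarrow> real" where
  "k2_makespan n = 4 * real (n div 2) + 3 * real (n mod 2)"

text \<open>Two gaps of length \<open>1\<close> cannot follow each other, as their sum \<open>2\<close> is forbidden. Hence removing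
  the two largest starting times lowers the bound \<open>B\<close> by \<open>4\<close>.\<close>

lemma k2_makespan_le:
  fixes A :: "real set"
  assumes "finite A" and "\<forall>x\<in>A. 0 \<le> x \<and> x + 3 \<le> B" and "0 \<le> B"
    and "\<forall>x\<in>A. \<forall>y\<in>A. x \<noteq> y \<longrightarrow> \<bar>x - y\<bar> = 1 \<or> 3 \<le> \<bar>x - y\<bar>"
  shows "k2_makespan (card A) \<le> B"
  using assms
proof (induction "card A" arbitrary: A B rule: less_induct)
  case less
  consider "card A = 0" | "card A = 1" | "2 \<le> card A" by linarith
  then show ?case
  proof cases
    case 1
    then show ?thesis using less.prems by (simp add: k2_makespan_def)
  next
    case 2
    then obtain x where "A = {x}" by (auto simp: card_1_singleton_iff)
    then show ?thesis using less.prems by (auto simp: k2_makespan_def)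
  next
    case 3
    define a where "a = Max A"
    define b where "b = Max (A - {a})"
    have "A \<noteq> {}" using 3 by auto
    then have a: "a \<in> A" "\<And>x. x \<in> A \<Longrightarrow> x \<le> a" using less.prems(1) by (auto simp: a_def)
    have "card (A - {a}) \<noteq> 0" using 3 a less.prems(1) by (simp add: card_Diff_singleton)
    then have "A - {a} \<noteq> {}" by force
    then have "b \<in> A - {a}" and b: "\<And>x. x \<in> A - {a} \<Longrightarrow> x \<le> b"
      using less.prems(1) Max_in[of "A - {a}"] by (auto simp: b_def)
    then have bA: "b \<in> A" "b < a" using a(2)[of b] by auto
    have far: "c + 4 \<le> a" if "c \<in> A - {a, b}" for c
    proof -
      have c: "c \<in> A" "c < b" using that b[of c] by auto
      with bA less.prems(4) a(1) have
        "\<bar>a - b\<bar> = 1 \<or> 3 \<le> \<bar>a - b\<bar>" "\<bar>b - c\<bar> = 1 \<or> 3 \<le> \<bar>b - c\<bar>" "\<bar>a - c\<bar> = 1 \<or> 3 \<le> \<bar>a - c\<bar>"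
        by (metis less_irrefl order.strict_trans)+
      with c bA show ?thesis by (auto simp: abs_if split: if_splits)
    qed
    have card: "card A = card (A - {a, b}) + 2"
      using 3 a bA less.prems(1) by (simp add: card_Diff_subset)
    have "\<bar>a - b\<bar> = 1 \<or> 3 \<le> \<bar>a - b\<bar>"
      using less.prems(4) a(1) bA(1) less_imp_neq[OF bA(2)] by metis
    moreover have "0 \<le> b" "a + 3 \<le> B" using less.prems(2) bA(1) a(1) by auto
    \<comment> \<open>If \<open>A\<close> is \<open>{a, b}\<close>, then \<open>far\<close> says
      nothing about \<open>B\<close>; the nonnegativity of \<open>B - 4\<close> comes from
      \<open>b + 1 \<le> a\<close> instead.\<close>
    ultimately have "4 \<le> B" using bA(2) by auto
    have "k2_makespan (card (A - {a, b})) \<le> B - 4"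
    proof (rule less.hyps)
      show "\<forall>x\<in>A - {a, b}. 0 \<le> x \<and> x + 3 \<le> B - 4"
      proof
        fix x assume x: "x \<in> A - {a, b}"
        with less.prems(2) have "0 \<le> x" by blast
        with far[OF x] \<open>a + 3 \<le> B\<close> show "0 \<le> x \<and> x + 3 \<le> B - 4" by linarith
      qed
      show "card (A - {a, b}) < card A" using card by linarith
      show "finite (A - {a, b})" using less.prems(1) by blast
      show "\<forall>x\<in>A - {a, b}. \<forall>y\<in>A - {a, b}. x \<noteq> y \<longrightarrow> \<bar>x - y\<bar> = 1 \<or> 3 \<le> \<bar>x - y\<bar>"
        using less.prems(4) by blast
    qed (use \<open>4 \<le> B\<close> in linarith)
    then show ?thesis unfolding card by (simp add: k2_makespan_def)
  qed
qed

text \<open>The analogue for one machine: all other elements lie at least 3 below the largest one,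
  so removing it lowers \<open>B\<close> by 3.\<close>

lemma separated_makespan_le:
  fixes A :: "real set"
  assumes "finite A" and "\<forall>x\<in>A. 0 \<le> x \<and> x + 3 \<le> B" and "0 \<le> B"
    and "\<forall>x\<in>A. \<forall>y\<in>A. x \<noteq> y \<longrightarrow> 3 \<le> \<bar>x - y\<bar>"
  shows "3 * real (card A) \<le> B"
  using assms
proof (induction A arbitrary: B rule: finite_linorder_max_induct)
  case (insert a A)
  have "3 * real (card A) \<le> B - 3"
  proof (rule insert.IH)
    show "\<forall>x\<in>A. 0 \<le> x \<and> x + 3 \<le> B - 3"
    proof
      fix x assume x: "x \<in> A"
      with insert.hyps(2) have "x < a" by blast
      with insert.prems(3) x have "3 \<le> \<bar>x - a\<bar>" by force
      with \<open>x < a\<close> insert.prems(1) x show "0 \<le> x \<and> x + 3 \<le> B - 3" by force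
    qed
  qed (use insert.prems in auto)
  moreover have "a \<notin> A" using insert.hyps(2) by blast
  ultimately show ?case using insert.hyps(1) by simp
qed simp

lemma start_le_makespan: "(i, s) \<in> set P \<Longrightarrow> s + 3 \<le> makespan P"
  unfolding makespan_def by (rule Max_ge) force+

lemma makespan_nonneg: "0 \<le> makespan P"
  by (simp add: makespan_def)

lemma makespan_le: "(\<And>i s. (i, s) \<in> set P \<Longrightarrow> s + 3 \<le> B) \<Longrightarrow> 0 \<le> B \<Longrightarrow> makespan P \<le> B"
  unfolding makespan_def by (subst Max_le_iff) auto

text \<open>Reduces schedules to sets of reals, to which the two counting bounds apply. Distinct
  jobs start at distinct times, so no job is lost in the image. The conjunct
  \<open>m \<noteq> 1\<close> lets one statement serve both bounds.\<close>

lemma start_times_conflict_free: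
  assumes "conflict_free_schedule (complete_graph m) n P"
  shows "card (snd ` set P) = n"
    and "\<forall>x\<in>snd ` set P. 0 \<le> x \<and> x + 3 \<le> makespan P"
    and "\<forall>x\<in>snd ` set P. \<forall>y\<in>snd ` set P. x \<noteq> y \<longrightarrow> \<bar>x - y\<bar> = 1 \<and> m \<noteq> 1 \<or> 3 \<le> \<bar>x - y\<bar>"
proof -
  note cf = assms[unfolded conflict_free_complete_graph_iff]
  have sep: "3 \<le> \<bar>snd (P ! j) - snd (P ! k)\<bar> \<or>
      fst (P ! j) \<noteq> fst (P ! k) \<and> \<bar>snd (P ! j) - snd (P ! k)\<bar> = 1"
    if "j < n" "k < n" "j \<noteq> k" for j k using cf that by blast
  have "distinct (map snd P)"
  proof (subst distinct_conv_nth, intro allI impI)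
    fix j k assume "j < length (map snd P)" "k < length (map snd P)" "j \<noteq> k"
    then have "j < length P" "k < length P" "j \<noteq> k" by auto
    moreover from this have "snd (P ! j) \<noteq> snd (P ! k)" using sep[of j k] cf by force
    ultimately show "map snd P ! j \<noteq> map snd P ! k" by simp
  qed
  then have "card (set (map snd P)) = length (map snd P)" by (rule distinct_card)
  then show "card (snd ` set P) = n" using cf by simp
  show "\<forall>x\<in>snd ` set P. 0 \<le> x \<and> x + 3 \<le> makespan P"
    using cf start_le_makespan[of _ _ P] by auto
  show "\<forall>x\<in>snd ` set P. \<forall>y\<in>snd ` set P. x \<noteq> y \<longrightarrow> \<bar>x - y\<bar> = 1 \<and> m \<noteq> 1 \<or> 3 \<le> \<bar>x - y\<bar>"
  proof (intro ballI impI)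
    fix x y assume xy: "x \<in> snd ` set P" "y \<in> snd ` set P" "x \<noteq> y"
    have "\<exists>j<n. z = snd (P ! j)" if z: "z \<in> snd ` set P" for z
    proof -
      from z obtain p where "p \<in> set P" "z = snd p" by blast
      with cf show ?thesis by (metis in_set_conv_nth)
    qed
    from this[OF xy(1)] this[OF xy(2)]
    obtain j k where jk: "j < n" "k < n" "x = snd (P ! j)" "y = snd (P ! k)" by blast
    have "fst (P ! i) < m" if "i < n" for i
      using cf that nth_mem[of i P] by (cases "P ! i") auto
    from this[OF jk(1)] this[OF jk(2)] show "\<bar>x - y\<bar> = 1 \<and> m \<noteq> 1 \<or> 3 \<le> \<bar>x - y\<bar>"
      using sep[of j k] jk xy(3) by (cases "m = 1") auto
  qed
qed

lemma k2_makespan_le_makespan: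
  assumes "conflict_free_schedule (complete_graph m) n P"
  shows "k2_makespan n \<le> makespan P"
  using k2_makespan_le[of "snd ` set P" "makespan P"] start_times_conflict_free[OF assms]
    makespan_nonneg[of P] by auto

lemma makespan_single_machine_ge:
  assumes "conflict_free_schedule (complete_graph 1) n P"
  shows "3 * real n \<le> makespan P"
  using separated_makespan_le[of "snd ` set P" "makespan P"] start_times_conflict_free[OF assms]
    makespan_nonneg[of P] by auto

section \<open>Schedules that attain the bounds\<close>

definition alternating_schedule :: "nat \<Rightarrow> nat schedule" where
  "alternating_schedule n = map (\<lambda>j. (j mod 2, real (4 * (j div 2) + j mod 2))) [0..<n]"

definition sequential_schedule :: "nat \<Rightarrow> nat schedule" where
  "sequential_schedule n = map (\<lambda>j. (0, real (3 * j))) [0..<n]"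

text \<open>Within a pair the machines differ and the gap is 1. Between different pairs the gap is
  at least 4 - 1 = 3.\<close>

lemma conflict_free_alternating_schedule:
  "conflict_free_schedule (complete_graph 2) n (alternating_schedule n)"
proof -
  have *: "3 \<le> \<bar>real (4 * (j div 2) + j mod 2) - real (4 * (k div 2) + k mod 2)\<bar> \<or>
      j mod 2 \<noteq> k mod 2 \<and> \<bar>real (4 * (j div 2) + j mod 2) - real (4 * (k div 2) + k mod 2)\<bar> = 1"
    if "j \<noteq> k" for j k :: nat
  proof -
    \<comment> \<open>With quotients and remainders as opaque variables, the claim is linear
      arithmetic over cases.\<close>
    define a b c d where "a = j div 2" and "b = j mod 2" and "c = k div 2" and "d = k mod 2"
    have "b < 2" "d < 2" by (auto simp: b_def d_def)
    have "\<not> (a = c \<and> b = d)"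
      using that unfolding a_def b_def c_def d_def by (metis div_mod_decomp)
    then have "a < c \<or> c < a \<or> a = c \<and> b \<noteq> d" by auto
    with \<open>b < 2\<close> \<open>d < 2\<close> show ?thesis
      unfolding a_def[symmetric] b_def[symmetric] c_def[symmetric] d_def[symmetric]
      by (auto simp: abs_if less_2_cases_iff)
  qed
  show ?thesis
    unfolding conflict_free_complete_graph_iff
    using * by (auto simp: alternating_schedule_def)
qed

lemma makespan_alternating_schedule: "makespan (alternating_schedule n) = k2_makespan n"
proof (rule antisym)
  show "makespan (alternating_schedule n) \<le> k2_makespan n"
  proof (rule makespan_le)
    fix i s assume "(i, s) \<in> set (alternating_schedule n)"
    then obtain j where j: "j < n" "s = real (4 * (j div 2) + j mod 2)"
      by (auto simp: alternating_schedule_def)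
    have "4 * (j div 2) + j mod 2 + 3 \<le> 4 * (n div 2) + 3 * (n mod 2)"
    proof -
      \<comment> \<open>If \<open>a < c\<close>, the left side is at most \<open>4 * a + 4\<close>.
        If \<open>a = c\<close>, then \<open>b = 0\<close> and \<open>d = 1\<close>, and both sides
        agree.\<close>
      have arith: "4 * a + b + 3 \<le> 4 * c + 3 * d" if "2 * a + b < 2 * c + d" "b < 2" "d < 2"
        for a b c d :: nat using that by (cases a c rule: linorder_cases) auto
      have "2 * (j div 2) + j mod 2 < 2 * (n div 2) + n mod 2" using j(1) by simp
      from arith[OF this] show ?thesis by simp
    qed
    then have "real (4 * (j div 2) + j mod 2 + 3) \<le> real (4 * (n div 2) + 3 * (n mod 2))"
      by (rule of_nat_mono)
    then show "s + 3 \<le> k2_makespan n" by (simp add: j(2) k2_makespan_def)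
  qed (simp add: k2_makespan_def)
  show "k2_makespan n \<le> makespan (alternating_schedule n)"
    by (rule k2_makespan_le_makespan[OF conflict_free_alternating_schedule])
qed

lemma optimal_alternating_schedule:
  "optimal_schedule (complete_graph 2) n (alternating_schedule n)"
  by (simp add: optimal_schedule_def conflict_free_alternating_schedule
      makespan_alternating_schedule k2_makespan_le_makespan)

lemma optimal_sequential_schedule:
  "optimal_schedule (complete_graph 1) n (sequential_schedule n)"
  unfolding optimal_schedule_def
proof (intro conjI allI impI)
  show "conflict_free_schedule (complete_graph 1) n (sequential_schedule n)"
    unfolding conflict_free_complete_graph_iff by (auto simp: sequential_schedule_def abs_if)
  fix Q assume "conflict_free_schedule (complete_graph 1) n Q"
  then have "3 * real n \<le> makespan Q" by (rule makespan_single_machine_ge)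
  moreover have "makespan (sequential_schedule n) \<le> 3 * real n"
    by (rule makespan_le) (auto simp: sequential_schedule_def)
  ultimately show "makespan (sequential_schedule n) \<le> makespan Q" by simp
qed

section \<open>Placing a schedule on other machines\<close>

lemma makespan_place_on: "makespan (place_on f P) = makespan P"
proof -
  have "(\<lambda>(i, s). s + 3) ` set (place_on f P) = (\<lambda>(i, s). s + 3) ` set P"
    by (force simp: place_on_def image_iff)
  then show ?thesis by (simp add: makespan_def)
qed

text \<open>On complete graphs machines enter the pairwise condition only through equality, which an
  injective renaming preserves.\<close>

lemma conflict_free_place_on:
  assumes P: "conflict_free_schedule (complete_graph l) n P"
    and f: "inj_on f {..<l}" "f ` {..<l} \<subseteq> {..<m}"
  shows "conflict_free_schedule (complete_graph m) n (place_on f P)"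
proof -
  note cf = P[unfolded conflict_free_complete_graph_iff]
  have nth: "fst (place_on f P ! j) = f (fst (P ! j)) \<and> snd (place_on f P ! j) = snd (P ! j) \<and>
      fst (P ! j) < l" if "j < n" for j
    using cf that nth_mem[of j P] by (cases "P ! j") (auto simp: place_on_def)
  have "f (fst (P ! j)) \<noteq> f (fst (P ! k))" if "j < n" "k < n" "fst (P ! j) \<noteq> fst (P ! k)" for j k
    using f(1) nth that by (auto dest: inj_onD)
  with cf nth have "\<forall>j<n. \<forall>k<n. j \<noteq> k \<longrightarrow>
      3 \<le> \<bar>snd (place_on f P ! j) - snd (place_on f P ! k)\<bar> \<or>
      fst (place_on f P ! j) \<noteq> fst (place_on f P ! k) \<and>
      \<bar>snd (place_on f P ! j) - snd (place_on f P ! k)\<bar> = 1" by metis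
  moreover have "\<forall>(i, s)\<in>set (place_on f P). i < m \<and> 0 \<le> s"
  proof clarify
    fix i s assume "(i, s) \<in> set (place_on f P)"
    then obtain a where a: "(a, s) \<in> set P" "i = f a" by (auto simp: place_on_def)
    with cf have "a < l" "0 \<le> s" by auto
    with a(2) f(2) show "i < m \<and> 0 \<le> s" by auto
  qed
  ultimately show ?thesis
    using cf by (simp add: conflict_free_complete_graph_iff place_on_def)
qed

text \<open>The bound \<open>k2_makespan n\<close> holds for every \<open>m\<close> and is attained
  on two machines, so further machines cannot help.\<close>

lemma optimal_place_on:
  assumes P: "optimal_schedule (complete_graph 2) n P"
    and f: "inj_on f {..<2}" "f ` {..<2} \<subseteq> {..<m}"
  shows "optimal_schedule (complete_graph m) n (place_on f P)"
    and "makespan (place_on f P) = k2_makespan n"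
proof -
  have cf: "conflict_free_schedule (complete_graph 2) n P" using P by (simp add: optimal_schedule_def)
  \<comment> \<open>Comparison with one explicit schedule fixes the makespan of an arbitrary optimal
    \<open>P\<close>.\<close>
  have "makespan P \<le> makespan (alternating_schedule n)"
    using P conflict_free_alternating_schedule by (auto simp: optimal_schedule_def)
  with k2_makespan_le_makespan[OF cf] show ms: "makespan (place_on f P) = k2_makespan n"
    by (simp add: makespan_place_on makespan_alternating_schedule)
  show "optimal_schedule (complete_graph m) n (place_on f P)"
    unfolding optimal_schedule_def ms
    using conflict_free_place_on[OF cf f] k2_makespan_le_makespan by blast
qed


section \<open>Descriptions of the optimal schedules\<close>

definition sequential_description :: "nat \<Rightarrow> description" where
  "sequential_description n = [(n, 3, [(0, 0)])]"

text \<open>The first block stays even if it is repeated zero times, so that the encoding is always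
  the word of \<open>n div 2\<close> followed by one of two fixed words.\<close>

definition alternating_description :: "nat \<Rightarrow> description" where
  "alternating_description n =
     (n div 2, 4, [(0, 0), (1, 1)]) # (if odd n then [(1, 3, [(0, 0)])] else [])"

lemma described_sequential: "described_schedule (sequential_description n) = sequential_schedule n"
proof -
  have "concat (map (\<lambda>l. [(0 :: nat, real (l * 3))]) [0..<n]) =
      map (\<lambda>j. (0, real (3 * j))) [0..<n]" by (induction n) auto
  then show ?thesis
    by (simp add: described_schedule_def sequential_description_def sequential_schedule_def)
qed

lemma described_alternating:
  "described_schedule (alternating_description n) = alternating_schedule n"
proof -
  have *: "concat (map (\<lambda>l. [(0, real (l * 4)), (1, real (l * 4 + 1))]) [0..<k]) =
      alternating_schedule (2 * k)" for k
    by (induction k) (auto simp: alternating_schedule_def)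
  have "described_schedule (alternating_description n) =
      alternating_schedule (2 * (n div 2)) @
        (if odd n then [(0, real (4 * (n div 2)))] else [])"
    unfolding *[symmetric]
    by (simp add: described_schedule_def alternating_description_def mult.commute add.commute)
  also have "\<dots> = alternating_schedule n"
  proof (cases "odd n")
    case True
    then obtain k where "n = 2 * k + 1" by (auto elim: oddE)
    then show ?thesis by (simp add: alternating_schedule_def)
  qed auto
  finally show ?thesis .
qed

text \<open>The part of an encoded block behind the repetition count. For the blocks used here it
  does not depend on \<open>n\<close>, so the finite control can store it.\<close>

definition block_tail :: "nat \<Rightarrow> (nat \<times> nat) list \<Rightarrow> symbol list" where
  "block_tail p js =
     Sep # encode_number p @ concat (map (\<lambda>(i, s). encode_number i @ encode_number s) js) @ [End]"

lemma encode_block_tail: "encode_block (r, p, js) = binary_word r @ block_tail p js"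
  by (simp add: block_tail_def encode_number_def)

lemma Blank_notin_binary_word: "Blank \<notin> set (binary_word n)"
  using set_binary_word[of n] by auto

lemma Blank_notin_block_tail: "Blank \<notin> set (block_tail p js)"
  using Blank_notin_binary_word by (auto simp: block_tail_def encode_number_def)


section \<open>The Turing machine\<close>

definition sequential_tail :: "symbol list" where
  "sequential_tail = block_tail 3 [(0, 0)]"

definition even_tail :: "symbol list" where
  "even_tail = block_tail 4 [(0, 0), (1, 1)]"

definition odd_tail :: "symbol list" where
  "odd_tail = even_tail @ encode_block (1, 3, [(0, 0)])"

lemma encode_sequential_description:
  "encode_description (sequential_description n) = binary_word n @ sequential_tail"
  by (simp add: encode_description_def sequential_description_def sequential_tail_def
      encode_block_tail del: encode_block.simps)

lemma encode_alternating_description: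
  "encode_description (alternating_description n) =
     binary_word (n div 2) @ (if odd n then odd_tail else even_tail)"
  by (simp add: encode_description_def alternating_description_def odd_tail_def even_tail_def
      encode_block_tail del: encode_block.simps)

lemma Blank_notin_tails:
  "Blank \<notin> set sequential_tail" "Blank \<notin> set even_tail" "Blank \<notin> set odd_tail"
  using Blank_notin_block_tail Blank_notin_binary_word
  by (auto simp: sequential_tail_def even_tail_def odd_tail_def encode_block_tail
      simp del: encode_block.simps)

definition tails :: "symbol list" where
  "tails = sequential_tail @ Blank # even_tail @ Blank # odd_tail @ [Blank]"

text \<open>Where the word belonging to the copying state \<open>q\<close> begins in
  \<open>tails\<close>; the summands 1 and 2 count separating blanks.\<close>

definition tail_position :: "nat \<Rightarrow> nat" where
  "tail_position q =
     (if q = 2 then 0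
      else if q = 3 then length sequential_tail + 1
      else length sequential_tail + length even_tail + 2)"

text \<open>States \<open>0\<close> and \<open>1\<close> find out whether \<open>m = 1\<close> and skip the lowest bit of \<open>n\<close> if \<open>m \<ge> 2\<close>, so
  that the remaining bits are those of \<open>n div 2\<close>. The states \<open>2\<close>, \<open>3\<close> and \<open>4\<close> (one machine, \<open>n\<close> even,
  \<open>n\<close> odd) copy these bits, and state \<open>5 + j\<close> writes the \<open>j\<close>-th symbol of \<open>tails\<close>, halting at a
  blank.\<close>

definition scheduler_transition ::
    "nat \<Rightarrow> symbol list \<Rightarrow> (nat \<times> (symbol \<times> move) list) option" where
  "scheduler_transition q xs =
     (let x = xs ! 0; y = xs ! 1; z = xs ! 2 in
      if q = 0 then Some (1, [(x, Stay), (y, Right), (z, Stay)])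
      else if q = 1 then
        (if y = Blank then Some (2, [(x, Stay), (y, Stay), (z, Stay)])
         else if x = Blank then Some (3, [(x, Stay), (y, Stay), (z, Stay)])
         else Some (if x = Bit True then 4 else 3, [(x, Right), (y, Stay), (z, Stay)]))
      else if q < 5 then
        (if x = Blank then Some (5 + tail_position q, [(x, Stay), (y, Stay), (z, Stay)])
         else Some (q, [(x, Right), (y, Stay), (x, Right)]))
      else if q - 5 < length tails \<and> tails ! (q - 5) \<noteq> Blank then
        Some (q + 1, [(x, Stay), (y, Stay), (tails ! (q - 5), Right)])
      else None)"

text \<open>The first tape holds \<open>n\<close>, the second holds \<open>m\<close>, and the third
  receives the description.\<close>

definition scheduler :: turing_machine where
  "scheduler =
     \<lparr>num_tapes = 3, num_states = 6 + length tails, transition = scheduler_transition\<rparr>"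

lemma wf_scheduler: "wf_turing_machine scheduler"
  by (auto simp: wf_turing_machine_def scheduler_def scheduler_transition_def Let_def
      tail_position_def tails_def split: if_splits)

section \<open>Runs of the machine\<close>

lemma tape_content_snoc: "(tape_content v)(length v := x) = tape_content (v @ [x])"
  by (auto simp: tape_content_def nth_append fun_eq_iff)

text \<open>A step that leaves a tape alone still rewrites the scanned symbol; at the end of a word
  this is a blank and changes nothing.\<close>

lemma tape_content_snoc_Blank: "tape_content (v @ [Blank]) = tape_content v"
  by (auto simp: tape_content_def nth_append fun_eq_iff)

lemma tape_content_head: "tape_content (a @ x # b) (length a) = x"
  by (simp add: tape_content_def)

lemma tape_content_end: "tape_content a (length a) = Blank"
  by (simp add: tape_content_def)

lemmas scheduler_step_simps =
  step_def scheduler_def scheduler_transition_def Let_def tape_content_snoc tape_content_head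
  tape_content_end

text \<open>Each step copies one symbol of \<open>b\<close>. The passed input \<open>a\<close> and
  the output \<open>v\<close> stay arbitrary because both grow during the induction.\<close>

lemma scheduler_copy:
  assumes "q \<in> {2, 3, 4}" and "Blank \<notin> set b"
  shows "(step scheduler ^^ length b)
      (q, [(tape_content (a @ b), length a), t, (tape_content v, length v)]) =
      (q, [(tape_content (a @ b), length (a @ b)), t, (tape_content (v @ b), length (v @ b))])"
  using assms(2)
proof (induction b arbitrary: a v)
  case (Cons x b)
  have "step scheduler (q, [(tape_content (a @ x # b), length a), t, (tape_content v, length v)]) =
      (q, [(tape_content ((a @ [x]) @ b), length (a @ [x])), t,
        (tape_content (v @ [x]), length (v @ [x]))])"
    using assms(1) Cons.prems by (cases t) (auto simp: scheduler_step_simps fun_upd_idem)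
  then show ?case
    using Cons.IH[of "a @ [x]" "v @ [x]"] Cons.prems by (simp add: funpow_Suc_right del: funpow.simps)
qed simp

text \<open>The state \<open>5 + length pre\<close> records the position in \<open>tails\<close>,
  and each step moves one symbol from \<open>u\<close> to \<open>pre\<close>.\<close>

lemma scheduler_write:
  assumes "tails = pre @ u @ rest" and "Blank \<notin> set u"
  shows "(step scheduler ^^ length u) (5 + length pre, [s, t, (tape_content v, length v)]) =
      (5 + length (pre @ u), [s, t, (tape_content (v @ u), length (v @ u))])"
  using assms
proof (induction u arbitrary: pre v)
  case (Cons x u)
  have "length pre < length tails" "tails ! length pre = x" "x \<noteq> Blank"
    unfolding Cons.prems(1) using Cons.prems(2) by auto
  then have "step scheduler (5 + length pre, [s, t, (tape_content v, length v)]) =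
      (5 + length (pre @ [x]), [s, t, (tape_content (v @ [x]), length (v @ [x]))])"
    by (cases s; cases t) (auto simp: scheduler_step_simps fun_upd_idem)
  then show ?case
    using Cons.IH[of "pre @ [x]" "v @ [x]"] Cons.prems by (simp add: funpow_Suc_right del: funpow.simps)
qed simp

lemma funpow_step_halted: "halted M C \<Longrightarrow> (step M ^^ k) C = C"
  by (induction k) (auto simp: halted_def step_def)

definition halted_with_output :: "config \<Rightarrow> symbol list \<Rightarrow> bool" where
  "halted_with_output C out \<longleftrightarrow> halted scheduler C \<and> fst (last (snd C)) = tape_content out"

lemma scheduler_copy_write:
  assumes "q \<in> {2, 3, 4}" and "Blank \<notin> set b"
    and "tails = pre @ u @ Blank # rest" and "Blank \<notin> set u" and "length pre = tail_position q"
    and "length b + 1 + length u \<le> k"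
  shows "halted_with_output
    ((step scheduler ^^ k) (q, [(tape_content (a @ b), length a), t, (tape_content [], 0)])) (b @ u)"
proof -
  let ?s = "(tape_content (a @ b), length (a @ b))"
  let ?C = "(5 + length (pre @ u), [?s, t, (tape_content (b @ u), length (b @ u))])"
  \<comment> \<open>From right to left: copying \<open>b\<close>, one step that jumps to the stored
    word, writing \<open>u\<close>, and \<open>l\<close> idle steps after halting.\<close>
  obtain l where k: "k = l + (length u + (1 + length b))"
    using assms(6) by (metis add.commute add.left_commute le_iff_add)
  have "step scheduler (q, [?s, t, (tape_content b, length b)]) =
      (5 + length pre, [?s, t, (tape_content b, length b)])"
    unfolding assms(5) using assms(1)
      tape_content_end[of "a @ b"]
    by (cases t) (auto simp: scheduler_step_simps tape_content_snoc_Blank fun_upd_idem)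
  then have "(step scheduler ^^ (1 + length b))
      (q, [(tape_content (a @ b), length a), t, (tape_content [], 0)]) =
      (5 + length pre, [?s, t, (tape_content b, length b)])"
    using scheduler_copy[OF assms(1,2), of a t "[]"] by simp
  moreover have "tails ! length (pre @ u) = Blank"
    unfolding assms(3) by (metis append_assoc nth_append_length)
  then have "halted scheduler ?C" by (cases t) (auto simp: halted_def scheduler_step_simps)
  ultimately have "(step scheduler ^^ k)
      (q, [(tape_content (a @ b), length a), t, (tape_content [], 0)]) = ?C"
    unfolding k funpow_add o_apply
    using scheduler_write[of pre u "Blank # rest" ?s t b] assms(3,4)
    by (simp add: funpow_step_halted del: length_append)
  then show ?thesis using \<open>halted scheduler ?C\<close> by (simp add: halted_with_output_def)
qed

text \<open>Two steps for the choice of the branch, then a bound common to all branches; the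
  separators in \<open>tails\<close> pay for the jump. Idle steps fill the rest.\<close>

definition scheduler_time :: "nat \<Rightarrow> nat" where
  "scheduler_time n = length (binary_word n) + length tails + 2"

lemma binary_word_nonzero:
  "n \<noteq> 0 \<Longrightarrow> binary_word n = Bit (odd n) # binary_word (n div 2)"
  by (simp add: binary_word.simps[of n])

lemma binary_word_zero: "binary_word 0 = []"
  by (simp add: binary_word.simps)

lemma scheduler_initial_config:
  "initial_config scheduler [v, w] =
     (0, [(tape_content v, 0), (tape_content w, 0), (tape_content [], 0)])"
  by (simp add: initial_config_def scheduler_def upt_rec)

text \<open>For \<open>m \<ge> 1\<close> the second cell of the word of \<open>m\<close> is blank
  exactly if \<open>m = 1\<close>. The lowest bit of \<open>n\<close> comes first, so one move to
  the right both reveals the parity and leaves \<open>n div 2\<close>. For \<open>n = 0\<close> the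
  word is empty and the head stays.\<close>

lemma scheduler_branch:
  assumes "1 \<le> m"
  obtains t where "(step scheduler ^^ 2) (initial_config scheduler [binary_word n, binary_word m]) =
    (if m = 1 then (2, [(tape_content (binary_word n), 0), t, (tape_content [], 0)])
     else (if odd n then 4 else 3,
       [(tape_content (binary_word n), if n = 0 then 0 else 1), t, (tape_content [], 0)]))"
proof
  have "tape_content (binary_word m) (Suc 0) = Blank \<longleftrightarrow> m = 1"
    using assms Blank_notin_binary_word[of "m div 2"]
    by (cases "m div 2 = 0")
      (auto simp: binary_word_nonzero binary_word_zero tape_content_def)
  moreover have "tape_content (binary_word n) 0 = (if n = 0 then Blank else Bit (odd n))"
    by (simp add: binary_word_nonzero binary_word_zero tape_content_def)
  ultimately show "(step scheduler ^^ 2) (initial_config scheduler [binary_word n, binary_word m]) =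
    (if m = 1 then (2, [(tape_content (binary_word n), 0), (tape_content (binary_word m), 1),
       (tape_content [], 0)])
     else (if odd n then 4 else 3,
       [(tape_content (binary_word n), if n = 0 then 0 else 1), (tape_content (binary_word m), 1),
        (tape_content [], 0)]))"
    unfolding scheduler_initial_config
    by (auto simp: numeral_2_eq_2 step_def scheduler_def scheduler_transition_def Let_def fun_upd_idem)
qed

lemma scheduler_computes:
  assumes "1 \<le> m"
  shows "computes_within scheduler (scheduler_time n) [binary_word n, binary_word m]
    (encode_description (if m = 1 then sequential_description n else alternating_description n))"
proof -
  obtain t where t: "(step scheduler ^^ 2)
      (initial_config scheduler [binary_word n, binary_word m]) =
    (if m = 1 then (2, [(tape_content (binary_word n), 0), t, (tape_content [], 0)])
     else (if odd n then 4 else 3,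
       [(tape_content (binary_word n), if n = 0 then 0 else 1), t, (tape_content [], 0)]))"
    using scheduler_branch[OF assms] by blast
  define k where "k = length (binary_word n) + length tails"
  have time: "scheduler_time n = k + 2" by (simp add: scheduler_time_def k_def)
  have "halted_with_output ((step scheduler ^^ scheduler_time n)
      (initial_config scheduler [binary_word n, binary_word m]))
      (encode_description
        (if m = 1 then sequential_description n else alternating_description n))"
  proof (cases "m = 1")
    \<comment> \<open>A single machine needs the full count \<open>n\<close>, so no bit is
      skipped.\<close>
    case True
    have "halted_with_output ((step scheduler ^^ k)
        (2, [(tape_content ([] @ binary_word n), length ([] :: symbol list)), t,
          (tape_content [], 0)]))
        (binary_word n @ sequential_tail)"
      by (rule scheduler_copy_write[where pre = "[]"
            and rest = "even_tail @ Blank # odd_tail @ [Blank]"])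
        (simp_all add: Blank_notin_binary_word Blank_notin_tails tails_def tail_position_def k_def)
    then show ?thesis
      unfolding time funpow_add o_apply t
      using True by (simp add: encode_sequential_description)
  next
    case False
    \<comment> \<open>The skipped prefix of the input; its length is the head position after
      branching, also for \<open>n = 0\<close>.\<close>
    define a where "a = (if n = 0 then [] else [Bit (odd n)])"
    have a: "binary_word n = a @ binary_word (n div 2)" "length a = (if n = 0 then 0 else 1)"
      by (auto simp: a_def binary_word_nonzero binary_word_zero)
    have "halted_with_output ((step scheduler ^^ k) (if odd n then 4 else 3,
        [(tape_content (a @ binary_word (n div 2)), length a), t, (tape_content [], 0)]))
        (binary_word (n div 2) @ (if odd n then odd_tail else even_tail))"
    proof (cases "odd n")
      case True
      have "halted_with_output ((step scheduler ^^ k) (4,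
        [(tape_content (a @ binary_word (n div 2)), length a), t, (tape_content [], 0)]))
        (binary_word (n div 2) @ odd_tail)"
        by (rule scheduler_copy_write[where pre = "sequential_tail @ Blank # even_tail @ [Blank]"
              and rest = "[]"])
          (simp_all add: Blank_notin_binary_word Blank_notin_tails tails_def tail_position_def
            k_def a(1))
      with True show ?thesis by simp
    next
      case False
      have "halted_with_output ((step scheduler ^^ k) (3,
        [(tape_content (a @ binary_word (n div 2)), length a), t, (tape_content [], 0)]))
        (binary_word (n div 2) @ even_tail)"
        by (rule scheduler_copy_write[where pre = "sequential_tail @ [Blank]"
              and rest = "odd_tail @ [Blank]"])
          (simp_all add: Blank_notin_binary_word Blank_notin_tails tails_def tail_position_def
            k_def a(1))
      with False show ?thesis by simp
    qed
    then show ?thesis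
      unfolding time funpow_add o_apply t
      using False by (simp only: encode_alternating_description a if_False)
  qed
  then show ?thesis
    by (simp add: computes_within_def halted_with_output_def Let_def) (simp add: scheduler_def)
qed

section \<open>Logarithmic running time\<close>

lemma power_length_binary_word: "n \<noteq> 0 \<Longrightarrow> 2 ^ length (binary_word n) \<le> 2 * n"
proof (induction n rule: less_induct)
  case (less n)
  show ?case
  proof (cases "n div 2 = 0")
    case True
    with less.prems have "n = 1" by auto
    then show ?thesis by (simp add: binary_word_nonzero binary_word_zero)
  next
    case False
    with less have "2 ^ length (binary_word (n div 2)) \<le> 2 * (n div 2)" by auto
    also have "\<dots> \<le> n" by simp
    finally show ?thesis using less.prems by (simp add: binary_word_nonzero)
  qed
qed

lemma scheduler_time_bigo: "(\<lambda>n. real (scheduler_time n)) \<in> O(\<lambda>n. ln (real n))"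
proof -
  \<comment> \<open>The word of \<open>n\<close> has at most 1 + \<open>ln (real n) / ln 2\<close>
    bits, so \<open>c\<close> collects all constants. From \<open>n = 2\<close> on this quotient is
    at least 1 and absorbs them, giving the factor \<open>1 + c\<close>.\<close>
  define c where "c = real (length tails) + 3"
  have "real (scheduler_time n) \<le> (1 + c) / ln 2 * ln (real n)" if "2 \<le> n" for n
  proof -
    have "real (2 ^ length (binary_word n)) \<le> real (2 * n)"
      using power_length_binary_word[of n] that by (intro of_nat_mono) auto
    then have "ln (2 ^ length (binary_word n)) \<le> ln (2 * real n)"
      by (subst ln_le_cancel_iff) (use that in auto)
    then have "real (length (binary_word n)) * ln 2 \<le> ln 2 + ln (real n)"
      using that by (simp add: ln_realpow ln_mult)
    then have "real (length (binary_word n)) \<le> 1 + ln (real n) / ln 2"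
      by (simp add: field_simps)
    moreover have "c * 1 \<le> c * (ln (real n) / ln 2)"
      using that by (intro mult_left_mono) (auto simp: c_def)
    ultimately show ?thesis
      by (simp add: scheduler_time_def c_def ring_distribs add_divide_distrib)
  qed
  then have "\<forall>\<^sub>F n in sequentially.
      norm (real (scheduler_time n)) \<le> (1 + c) / ln 2 * norm (ln (real n))"
    by (intro eventually_sequentiallyI[of 2]) auto
  then show ?thesis by (rule bigoI)
qed

theorem lemma4p2:
  "(\<exists>(M :: turing_machine) (T :: nat \<Rightarrow> nat).
      wf_turing_machine M \<and> (\<lambda>n. real (T n)) \<in> O(\<lambda>n. ln (real n)) \<and>
      (\<forall>m n. 1 \<le> m \<longrightarrow>
         (\<exists>d. computes_within M (T n) [binary_word n, binary_word m] (encode_description d) \<and>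
              optimal_schedule (complete_graph m) n (described_schedule d) \<and>
              (2 \<le> m \<longrightarrow>
                 (\<exists>P f. optimal_schedule (complete_graph 2) n P \<and>
                        inj_on f {..<2} \<and> f ` {..<2} \<subseteq> {..<m} \<and>
                        described_schedule d = place_on f P)))))
   \<and> (\<forall>m n P f. 2 \<le> m \<longrightarrow> optimal_schedule (complete_graph 2) n P \<longrightarrow>
         inj_on f {..<2} \<longrightarrow> f ` {..<2} \<subseteq> {..<m} \<longrightarrow>
         optimal_schedule (complete_graph m) n (place_on f P) \<and>
         makespan (place_on f P) = 4 * real (n div 2) + 3 * real (n mod 2))"
proof (rule conjI)
  have "\<exists>d. computes_within scheduler (scheduler_time n) [binary_word n, binary_word m]
              (encode_description d) \<and>
            optimal_schedule (complete_graph m) n (described_schedule d) \<and>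
            (2 \<le> m \<longrightarrow>
               (\<exists>P f. optimal_schedule (complete_graph 2) n P \<and>
                      inj_on f {..<2} \<and> f ` {..<2} \<subseteq> {..<m} \<and>
                      described_schedule d = place_on f P))" if "1 \<le> m" for m n
  proof (cases "m = 1")
    case True
    then show ?thesis
      using scheduler_computes[OF that, of n] optimal_sequential_schedule[of n]
      by (intro exI[of _ "sequential_description n"]) (simp add: described_sequential)
  next
    case False
    \<comment> \<open>The description uses the machines 0 and 1 themselves, so the identity is the
      placement.\<close>
    with that have m: "id ` {..<2} \<subseteq> {..<m}" "inj_on (id :: nat \<Rightarrow> nat) {..<2}" by auto
    have id: "place_on (id :: nat \<Rightarrow> nat) (alternating_schedule n) = alternating_schedule n"
      by (simp add: place_on_def)
    show ?thesis
    proof (intro exI[of _ "alternating_description n"] conjI impI)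
      show "optimal_schedule (complete_graph m) n (described_schedule (alternating_description n))"
        using optimal_place_on(1)[OF optimal_alternating_schedule[of n] m(2,1)]
        by (simp only: id described_alternating)
      show "\<exists>P f. optimal_schedule (complete_graph 2) n P \<and>
          inj_on f {..<2} \<and> f ` {..<2} \<subseteq> {..<m} \<and>
          described_schedule (alternating_description n) = place_on f P"
        using m optimal_alternating_schedule id by (metis described_alternating)
    qed (use scheduler_computes[OF that, of n] False in simp)
  qed
  then show "\<exists>(M :: turing_machine) (T :: nat \<Rightarrow> nat).
      wf_turing_machine M \<and> (\<lambda>n. real (T n)) \<in> O(\<lambda>n. ln (real n)) \<and>
      (\<forall>m n. 1 \<le> m \<longrightarrow>
         (\<exists>d. computes_within M (T n) [binary_word n, binary_word m] (encode_description d) \<and>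
              optimal_schedule (complete_graph m) n (described_schedule d) \<and>
              (2 \<le> m \<longrightarrow>
                 (\<exists>P f. optimal_schedule (complete_graph 2) n P \<and>
                        inj_on f {..<2} \<and> f ` {..<2} \<subseteq> {..<m} \<and>
                        described_schedule d = place_on f P))))"
    using wf_scheduler scheduler_time_bigo by blast
qed (simp add: optimal_place_on[unfolded k2_makespan_def])

end
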